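(* Let $\gamma$ be a topological circle equipped with a Riemannian metric (so $n=\dim\gamma=1$), of length $2\pi$. The Lie algebra $\mathfrak H$ generated under the Poisson bracket by the functions $H_{0,f}$, $f\in C^\infty(\gamma)$, is $$\Lambda_1\oplus\Big(\bigoplus_{d\in2\mathbb Z_{\ge0}}\Lambda_d\Big)\oplus\Big(\bigoplus_{d\in2\mathbb Z_{\ge1}+1}\Lambda_{d,0}\Big)\oplus\Psi,$$ where $$\Psi=\Big\{\frac{P(y)}{\sqrt{1+y^2}}\ :\ P(y)=\sum_{j=1}^k a_jy^{2j+1},\ k\in\mathbb N,\ a_j\in\mathbb R,\ \widetilde P'(-1)=0\Big\},\qquad \widetilde P(x):=x^{-\frac12}P(x^{\frac12})=\sum_{j=1}^ka_jx^j .$$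
   Context: The metric is rescaled by a constant factor so that the length of $\gamma$ equals $2\pi$. Let $s\in\mathbb R/2\pi\mathbb Z$ be the natural (length) parameter on $\gamma$; it trivializes $T\gamma$, and $T_{<1}\gamma=\{(x,w)\in T\gamma:\|w\|<1\}=\gamma\times(-1,1)$ has coordinates $(s,w)$ and symplectic form $dw\wedge ds$, with Poisson bracket $\{F,G\}=\frac{\partial F}{\partial w}\frac{\partial G}{\partial s}-\frac{\partial F}{\partial s}\frac{\partial G}{\partial w}$. Functions of $(s,w)$ are rewritten as functions of $(s,y)\in\gamma\times\mathbb R$, $y=\frac{w}{\sqrt{1-w^2}}$ (the Poisson bracket being transported accordingly). For $d\in\mathbb Z_{\ge0}$ and $h\in C^\infty(\gamma)$ set $H_{d,h}(s,y)=\frac{h(s)y^d}{\sqrt{1+y^2}}$, $\Lambda_d=\{H_{d,h}: h\in C^\infty(\gamma)\}$, $\Lambda_{d,0}=\{H_{d,h}\in\Lambda_d:\int_0^{2\pi}h(s)\,ds=0\}$. (In the coordinates $(s,w)$, $H_{0,f}=f(s)\sqrt{1-w^2}$.) Direct sums consist of finite sums. *)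

theory Defs
  imports "HOL-Analysis.Analysis" "HOL-Library.Function_Algebras"
begin

text \<open>Pointwise real vector space structure on functions, extending the additive structure
  of \<^theory>\<open>HOL-Library.Function_Algebras\<close>.\<close>

instantiation "fun" :: (type, real_vector) real_vector
begin

definition scaleR_fun :: "real \<Rightarrow> ('a \<Rightarrow> 'b) \<Rightarrow> 'a \<Rightarrow> 'b"
  where "scaleR_fun c f = (\<lambda>x. c *\<^sub>R f x)"

instance
  by standard (auto simp: scaleR_fun_def plus_fun_def fun_eq_iff algebra_simps)

end

text \<open>A Riemannian circle of length \<open>2\<pi>\<close> is \<open>\<real>/2\<pi>\<int>\<close> via its length parameter \<open>s\<close>. A function on the
  circle is a \<open>2\<pi>\<close>-periodic function of \<open>s\<close>, and a function on (an open subset of) the tangent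
  bundle is a function of a pair \<open>(s, w)\<close> or \<open>(s, y)\<close>, \<open>2\<pi>\<close>-periodic in \<open>s\<close>.\<close>

definition smooth_circle :: "(real \<Rightarrow> real) set"
  where "smooth_circle =
    {h. (\<forall>s. h (s + 2 * pi) = h s) \<and> (\<forall>n s. ((deriv ^^ n) h) differentiable (at s))}"

text \<open>Poisson bracket of the symplectic form \<open>dw \<and> ds\<close> on the unit disc bundle \<open>\<bar>w\<bar> < 1\<close>.
  Values at \<open>\<bar>w\<bar> \<ge> 1\<close> are never used below.\<close>

definition poisson_sw :: "(real \<times> real \<Rightarrow> real) \<Rightarrow> (real \<times> real \<Rightarrow> real) \<Rightarrow> real \<times> real \<Rightarrow> real"
  where "poisson_sw F G = (\<lambda>(s, w).
      deriv (\<lambda>v. F (s, v)) w * deriv (\<lambda>t. G (t, w)) s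
    - deriv (\<lambda>t. F (t, w)) s * deriv (\<lambda>v. G (s, v)) w)"

text \<open>Change of fibre coordinate \<open>y = w / sqrt (1 - w\<^sup>2)\<close>, a bijection from \<open>(-1, 1)\<close> to \<open>\<real>\<close> with
  inverse \<open>w = y / sqrt (1 + y\<^sup>2)\<close>, acting on functions.\<close>

definition in_w_coord :: "(real \<times> real \<Rightarrow> real) \<Rightarrow> real \<times> real \<Rightarrow> real"
  where "in_w_coord F = (\<lambda>(s, w). F (s, w / sqrt (1 - w\<^sup>2)))"

definition in_y_coord :: "(real \<times> real \<Rightarrow> real) \<Rightarrow> real \<times> real \<Rightarrow> real"
  where "in_y_coord F = (\<lambda>(s, y). F (s, y / sqrt (1 + y\<^sup>2)))"

definition poisson :: "(real \<times> real \<Rightarrow> real) \<Rightarrow> (real \<times> real \<Rightarrow> real) \<Rightarrow> real \<times> real \<Rightarrow> real"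
  where "poisson F G = in_y_coord (poisson_sw (in_w_coord F) (in_w_coord G))"

definition H :: "nat \<Rightarrow> (real \<Rightarrow> real) \<Rightarrow> real \<times> real \<Rightarrow> real"
  where "H d h = (\<lambda>(s, y). h s * y ^ d / sqrt (1 + y\<^sup>2))"

text \<open>The least real linear subspace that contains \<open>S\<close> and is closed under the bracket.\<close>

inductive_set poisson_lie_algebra ::
    "(real \<times> real \<Rightarrow> real) set \<Rightarrow> (real \<times> real \<Rightarrow> real) set"
  for S :: "(real \<times> real \<Rightarrow> real) set"
  where
    generator: "F \<in> S \<Longrightarrow> F \<in> poisson_lie_algebra S"
  | zero: "0 \<in> poisson_lie_algebra S"
  | add: "F \<in> poisson_lie_algebra S \<Longrightarrow> G \<in> poisson_lie_algebra S \<Longrightarrow>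
      F + G \<in> poisson_lie_algebra S"
  | scale: "F \<in> poisson_lie_algebra S \<Longrightarrow> c *\<^sub>R F \<in> poisson_lie_algebra S"
  | bracket: "F \<in> poisson_lie_algebra S \<Longrightarrow> G \<in> poisson_lie_algebra S \<Longrightarrow>
      poisson F G \<in> poisson_lie_algebra S"

definition Lam :: "nat \<Rightarrow> (real \<times> real \<Rightarrow> real) set"
  where "Lam d = {H d h | h. h \<in> smooth_circle}"

definition Lam0 :: "nat \<Rightarrow> (real \<times> real \<Rightarrow> real) set"
  where "Lam0 d = {H d h | h. h \<in> smooth_circle \<and> integral {0..2 * pi} h = 0}"

text \<open>The condition is on the polynomial \<open>x \<mapsto> x\<^bsup>-1/2\<^esup> P(x\<^bsup>1/2\<^esup>)\<close>, that is \<open>a\<^sub>1 x + \<dots> + a\<^sub>k x\<^sup>k\<close>.\<close>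

definition Psi :: "(real \<times> real \<Rightarrow> real) set"
  where "Psi =
    {(\<lambda>(s, y). (\<Sum>j=1..k. a j * y ^ (2 * j + 1)) / sqrt (1 + y\<^sup>2)) | (k :: nat) (a :: nat \<Rightarrow> real).
      deriv (\<lambda>x. \<Sum>j=1..k. a j * x ^ j) (-1) = 0}"

text \<open>\<open>W\<close> is the internal direct sum of the subspaces \<open>V i\<close>, \<open>i \<in> I\<close> (finite sums only).\<close>

definition is_direct_sum :: "'v::real_vector set \<Rightarrow> 'i set \<Rightarrow> ('i \<Rightarrow> 'v set) \<Rightarrow> bool"
  where "is_direct_sum W I V \<longleftrightarrow>
    (\<forall>i\<in>I. subspace (V i)) \<and>
    W = {(\<Sum>i\<in>J. v i) | J v. finite J \<and> J \<subseteq> I \<and> (\<forall>i\<in>J. v i \<in> V i)} \<and>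
    (\<forall>J v. finite J \<longrightarrow> J \<subseteq> I \<longrightarrow> (\<forall>i\<in>J. v i \<in> V i) \<longrightarrow> (\<Sum>i\<in>J. v i) = 0 \<longrightarrow> (\<forall>i\<in>J. v i = 0))"

datatype summand = Full nat | Zero_Mean nat | Extra

fun summand_space :: "summand \<Rightarrow> (real \<times> real \<Rightarrow> real) set"
  where
    "summand_space (Full d) = Lam d"
  | "summand_space (Zero_Mean d) = Lam0 d"
  | "summand_space Extra = Psi"

end

theory Submission
  imports Defs "HOL-Computational_Algebra.Polynomial"
begin

text \<open>
  Everything rests on one formula. In the coordinates \<open>(s, y)\<close> the bracket is
  \<open>(1 + y\<^sup>2) sqrt (1 + y\<^sup>2)\<close> times the standard one, and therefore (\<open>poisson_H\<close>)
  \<open>{H d f, H e g}\<close> has exactly two homogeneous parts: degree \<open>d + e - 1\<close> with coefficient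
  \<open>d f g' - e f' g\<close>, and degree \<open>d + e + 1\<close> with coefficient \<open>(d - 1) f g' - (e - 1) f' g\<close>.

  Let \<open>\<mu>\<close> be the mean of \<open>f g'\<close> over the circle; by parts, \<open>f' g\<close> has mean \<open>- \<mu>\<close>. So the two
  coefficients have means \<open>(d + e) \<mu>\<close> and \<open>(d + e - 2) \<mu>\<close>. When \<open>d + e = 2 n\<close> the degrees are odd
  and, with \<open>x = y\<^sup>2\<close> and one factor \<open>y\<close> removed, the means contribute
  \<open>2 \<mu> (n x\<^bsup>n-1\<^esup> + (n - 1) x\<^sup>n)\<close>, whose derivative \<open>2 \<mu> n (n - 1) x\<^bsup>n-2\<^esup> (1 + x)\<close> vanishes
  at \<open>-1\<close>. This is the only constraint on the means, and \<open>Psi\<close> records it; degree \<open>1\<close>, that is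
  \<open>x\<^sup>0\<close>, escapes it because its derivative is zero. Hence the span of the summands contains
  every bracket (\<open>poisson_in_target\<close>).

  Conversely, bracketing with \<open>H 0 1\<close> replaces \<open>H e g\<close> by \<open>- H (e + 1) g'\<close>, and all functions of mean
  zero are derivatives, so degrees climb as far as zero means are concerned. The bracket
  \<open>{H 0 sin, H e cos}\<close> (\<open>bracket_sin_cos\<close>) supplies the missing means: its top coefficient has mean
  \<open>(2 - e) / 2\<close>, which completes the even degrees and degree \<open>1\<close>, and for even \<open>e \<ge> 4\<close> it gives
  the relations between neighbouring odd degrees that generate \<open>Psi\<close>.

  The sum is direct because coefficients of distinct powers of \<open>y\<close> separate, and in odd
  degree a constant cannot cancel a nonzero function of mean zero.
\<close>

section \<open>Smooth functions on the circle\<close>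

text \<open>
  The recursion differentiates the argument first, so that closure under products follows by
  induction from the product rule for one derivative, without a Leibniz formula.
\<close>

primrec differentiable_upto :: "nat \<Rightarrow> (real \<Rightarrow> real) \<Rightarrow> bool" where
  "differentiable_upto 0 f \<longleftrightarrow> (\<forall>s. f differentiable (at s))"
| "differentiable_upto (Suc n) f \<longleftrightarrow> (\<forall>s. f differentiable (at s)) \<and> differentiable_upto n (deriv f)"

lemma differentiable_upto_iff:
  "differentiable_upto n f \<longleftrightarrow> (\<forall>k\<le>n. \<forall>s. (deriv ^^ k) f differentiable (at s))"
proof (induction n arbitrary: f)
  case (Suc n)
  have "(\<forall>k\<le>Suc n. \<forall>s. (deriv ^^ k) f differentiable (at s)) \<longleftrightarrow>
    (\<forall>s. f differentiable (at s)) \<and> (\<forall>k\<le>n. \<forall>s. (deriv ^^ Suc k) f differentiable (at s))"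
    by (metis Suc_le_mono funpow_0 not0_implies_Suc zero_le)
  then show ?case
    by (simp add: Suc.IH funpow_Suc_right del: funpow.simps)
qed auto

lemma smooth_circle_iff:
  "h \<in> smooth_circle \<longleftrightarrow> (\<forall>s. h (s + 2 * pi) = h s) \<and> (\<forall>n. differentiable_upto n h)"
  by (auto simp: smooth_circle_def differentiable_upto_iff)

lemma differentiable_upto_imp_DERIV:
  "differentiable_upto n f \<Longrightarrow> (f has_real_derivative deriv f s) (at s)"
  by (cases n) (auto simp: DERIV_deriv_iff_real_differentiable)

lemma differentiable_upto_pred: "differentiable_upto (Suc n) f \<Longrightarrow> differentiable_upto n f"
  by (simp add: differentiable_upto_iff del: differentiable_upto.simps)

lemma differentiable_upto_SucI:
  assumes "\<And>s. (f has_real_derivative f' s) (at s)" "differentiable_upto n f'"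
  shows "differentiable_upto (Suc n) f"
proof -
  have "deriv f = f'"
    using assms(1) by (auto intro!: DERIV_imp_deriv)
  then show ?thesis
    using assms by (auto simp: real_differentiable_def)
qed

lemma differentiable_upto_const: "differentiable_upto n (\<lambda>s. c)"
proof (induction n arbitrary: c)
  case (Suc n)
  then show ?case by (intro differentiable_upto_SucI[where f' = "\<lambda>_. 0"]) auto
qed auto

lemma differentiable_upto_add:
  "differentiable_upto n f \<Longrightarrow> differentiable_upto n g \<Longrightarrow> differentiable_upto n (\<lambda>s. f s + g s)"
proof (induction n arbitrary: f g)
  case (Suc n)
  show ?case
  proof (rule differentiable_upto_SucI)
    show "differentiable_upto n (\<lambda>s. deriv f s + deriv g s)"
      using Suc by auto
  qed (intro DERIV_add Suc.prems[THEN differentiable_upto_imp_DERIV])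
qed auto

lemma differentiable_upto_mult:
  "differentiable_upto n f \<Longrightarrow> differentiable_upto n g \<Longrightarrow> differentiable_upto n (\<lambda>s. f s * g s)"
proof (induction n arbitrary: f g)
  case (Suc n)
  show ?case
  proof (rule differentiable_upto_SucI)
    show "differentiable_upto n (\<lambda>s. deriv f s * g s + deriv g s * f s)"
      using Suc differentiable_upto_pred[OF Suc.prems(1)] differentiable_upto_pred[OF Suc.prems(2)]
      by (intro differentiable_upto_add Suc.IH) auto
  qed (intro DERIV_mult Suc.prems[THEN differentiable_upto_imp_DERIV])
qed auto

lemma differentiable_upto_sin_cos: "differentiable_upto n sin \<and> differentiable_upto n cos"
proof (induction n)
  case 0
  show ?case
    by (auto simp: real_differentiable_def intro: DERIV_sin DERIV_cos)
next
  case (Suc n)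
  have "differentiable_upto (Suc n) sin"
    using Suc by (intro differentiable_upto_SucI[where f' = cos] DERIV_sin) auto
  moreover have "differentiable_upto (Suc n) cos"
    using differentiable_upto_mult[OF differentiable_upto_const[of n "-1"], of sin] Suc
    by (intro differentiable_upto_SucI[where f' = "\<lambda>s. - sin s"] DERIV_cos) auto
  ultimately show ?case ..
qed

lemma smooth_const: "(\<lambda>s. c) \<in> smooth_circle"
  and smooth_sin: "sin \<in> smooth_circle"
  and smooth_cos: "cos \<in> smooth_circle"
  using differentiable_upto_sin_cos by (auto simp: smooth_circle_iff differentiable_upto_const)

lemma smooth_add: "f \<in> smooth_circle \<Longrightarrow> g \<in> smooth_circle \<Longrightarrow> (\<lambda>s. f s + g s) \<in> smooth_circle"
  and smooth_mult: "f \<in> smooth_circle \<Longrightarrow> g \<in> smooth_circle \<Longrightarrow> (\<lambda>s. f s * g s) \<in> smooth_circle"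
  by (simp_all add: smooth_circle_iff differentiable_upto_add differentiable_upto_mult)

lemma smooth_cmult: "f \<in> smooth_circle \<Longrightarrow> (\<lambda>s. c * f s) \<in> smooth_circle"
  by (rule smooth_mult[OF smooth_const])

lemma smooth_minus: "f \<in> smooth_circle \<Longrightarrow> (\<lambda>s. - f s) \<in> smooth_circle"
  using smooth_cmult[of f "-1"] by simp

lemma smooth_diff: "f \<in> smooth_circle \<Longrightarrow> g \<in> smooth_circle \<Longrightarrow> (\<lambda>s. f s - g s) \<in> smooth_circle"
  using smooth_add[OF _ smooth_minus] by simp

lemma smooth_DERIV: "f \<in> smooth_circle \<Longrightarrow> (f has_real_derivative deriv f s) (at s)"
  using differentiable_upto_imp_DERIV by (auto simp: smooth_circle_iff)

text \<open>
  A primitive inherits smoothness from the function it integrates; only its periodicity remains to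
  be checked.
\<close>

lemma smooth_circleI_DERIV:
  assumes "\<And>s. f (s + 2 * pi) = f s" "\<And>s. (f has_real_derivative f' s) (at s)"
    "f' \<in> smooth_circle"
  shows "f \<in> smooth_circle"
proof -
  have "differentiable_upto n f" for n
    using differentiable_upto_SucI[OF assms(2), of n] assms(3)
    by (auto simp: smooth_circle_iff intro: differentiable_upto_pred)
  then show ?thesis
    using assms(1) by (simp add: smooth_circle_iff)
qed

lemma smooth_deriv:
  assumes "f \<in> smooth_circle"
  shows "deriv f \<in> smooth_circle"
proof -
  have "differentiable_upto n (deriv f)" for n
    using assms smooth_circle_iff differentiable_upto.simps(2) by blast
  moreover have "deriv f (s + 2 * pi) = deriv f s" for s
  proof -
    have "((\<lambda>t. f (t + 2 * pi)) has_real_derivative deriv f (s + 2 * pi)) (at s)"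
      using smooth_DERIV[OF assms, of "s + 2 * pi"] by (simp add: DERIV_shift add.commute)
    moreover have "(\<lambda>t. f (t + 2 * pi)) = f"
      using assms by (auto simp: smooth_circle_def)
    ultimately show ?thesis
      using DERIV_imp_deriv by metis
  qed
  ultimately show ?thesis
    by (simp add: smooth_circle_iff)
qed

lemma smooth_continuous: "f \<in> smooth_circle \<Longrightarrow> continuous_on S f"
  using smooth_DERIV DERIV_continuous_on by (metis has_field_derivative_at_within)

lemma smooth_integrable: "f \<in> smooth_circle \<Longrightarrow> f integrable_on {a..b}"
  by (rule integrable_continuous_real[OF smooth_continuous])

section \<open>Mean values and primitives\<close>

definition mean :: "(real \<Rightarrow> real) \<Rightarrow> real"
  where "mean h = integral {0..2 * pi} h / (2 * pi)"

lemma mean_eq_0_iff: "mean h = 0 \<longleftrightarrow> integral {0..2 * pi} h = 0"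
  by (simp add: mean_def)

lemma mean_const [simp]: "mean (\<lambda>s. c) = c"
  by (simp add: mean_def)

lemma mean_add:
  "f \<in> smooth_circle \<Longrightarrow> g \<in> smooth_circle \<Longrightarrow> mean (\<lambda>s. f s + g s) = mean f + mean g"
  by (simp add: mean_def integral_add smooth_integrable add_divide_distrib)

lemma mean_cmult: "mean (\<lambda>s. c * f s) = c * mean f"
  by (simp add: mean_def)

lemma mean_diff:
  "f \<in> smooth_circle \<Longrightarrow> g \<in> smooth_circle \<Longrightarrow> mean (\<lambda>s. f s - g s) = mean f - mean g"
  by (simp add: mean_def integral_diff smooth_integrable diff_divide_distrib)

lemma mean_deriv:
  assumes "\<And>s. (f has_real_derivative f' s) (at s)" "\<And>s. f (s + 2 * pi) = f s"
  shows "mean f' = 0"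
proof -
  have "(f' has_integral f (2 * pi) - f 0) {0..2 * pi}"
    using assms(1) by (intro fundamental_theorem_of_calculus)
      (auto simp flip: has_real_derivative_iff_has_vector_derivative
        intro: has_field_derivative_at_within)
  then show ?thesis
    using assms(2)[of 0] by (simp add: mean_def integral_unique)
qed

lemma mean_by_parts:
  assumes "f \<in> smooth_circle" "g \<in> smooth_circle"
  shows "mean (\<lambda>s. deriv f s * g s) = - mean (\<lambda>s. f s * deriv g s)"
proof -
  have "mean (\<lambda>s. deriv f s * g s + deriv g s * f s) = 0"
    using assms
    by (intro mean_deriv[where f = "\<lambda>s. f s * g s"] DERIV_mult smooth_DERIV)
      (auto simp: smooth_circle_def)
  then show ?thesis
    using assms by (simp add: mean_add smooth_mult smooth_deriv mult.commute)
qed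

lemma deriv_sin_cos: "deriv sin = (cos :: real \<Rightarrow> real)" "deriv cos = (\<lambda>s::real. - sin s)"
  by (auto intro!: DERIV_imp_deriv DERIV_sin DERIV_cos)

text \<open>
  The two means agree by parts, since \<open>sin' = cos\<close> and \<open>cos' = - sin\<close>, and they add up to \<open>1\<close>.
\<close>

lemma mean_cos_sq: "mean (\<lambda>s. cos s * cos s) = 1 / 2"
  and mean_sin_sq: "mean (\<lambda>s. sin s * sin s) = 1 / 2"
proof -
  let ?c = "mean (\<lambda>s. cos s * cos s)" and ?s = "mean (\<lambda>s. sin s * sin s)"
  have "?c = ?s"
    using mean_by_parts[OF smooth_sin smooth_cos] mean_cmult[of "-1" "\<lambda>s. sin s * sin s"]
    by (simp add: deriv_sin_cos)
  moreover have "?c + ?s = mean (\<lambda>s. cos s * cos s + sin s * sin s)"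
    by (intro mean_add[symmetric] smooth_mult smooth_sin smooth_cos)
  then have "?c + ?s = 1"
    by simp
  ultimately show "?c = 1 / 2" "?s = 1 / 2" by auto
qed

text \<open>
  A primitive on the whole line increases by the integral over one period, which is zero, so it
  is periodic; a constant is subtracted from it to make its own mean zero as well.
\<close>

lemma zero_mean_primitive:
  assumes "h \<in> smooth_circle" "mean h = 0"
  obtains g where "g \<in> smooth_circle" "mean g = 0" "deriv g = h"
proof -
  have "isCont h x" for x
    using smooth_DERIV[OF assms(1)] DERIV_isCont by blast
  then obtain G where G: "(G has_real_derivative h x) (at x)" for x
    using einterval_antiderivative[of "-\<infinity>" "\<infinity>" h]
    by (auto simp flip: has_real_derivative_iff_has_vector_derivative)
  have "((\<lambda>t. G (t + 2 * pi) - G t) has_real_derivative 0) (at s)" for s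
  proof -
    have "((\<lambda>t. G (t + 2 * pi)) has_real_derivative h s) (at s)"
      using G[of "s + 2 * pi"] assms(1) by (simp add: DERIV_shift smooth_circle_def add.commute)
    from DERIV_diff[OF this G[of s]] show ?thesis by simp
  qed
  then have shift: "G (s + 2 * pi) - G s = G (0 + 2 * pi) - G 0" for s
    by (rule DERIV_isconst_all[rule_format])
  have "(h has_integral G (2 * pi) - G 0) {0..2 * pi}"
    using G by (intro fundamental_theorem_of_calculus)
      (auto simp flip: has_real_derivative_iff_has_vector_derivative
        intro: has_field_derivative_at_within)
  then have "G (2 * pi) - G 0 = 0"
    using assms(2) by (simp add: mean_eq_0_iff integral_unique)
  then have per: "G (s + 2 * pi) = G s" for s
    using shift[of s] by simp
  have sG: "G \<in> smooth_circle"
    using per G assms(1) by (rule smooth_circleI_DERIV)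
  let ?g = "\<lambda>s. G s - mean G"
  show thesis
  proof
    show "?g \<in> smooth_circle"
      by (intro smooth_diff sG smooth_const)
    show "mean ?g = 0"
      using mean_diff[OF sG smooth_const] by simp
    have "(?g has_real_derivative h x) (at x)" for x
      using DERIV_diff[OF G DERIV_const] by simp
    then show "deriv ?g = h"
      by (auto intro!: DERIV_imp_deriv)
  qed
qed

section \<open>The bracket in the coordinates \<open>(s, y)\<close>\<close>

text \<open>
  Separate differentiability is enough, since the bracket takes derivatives only along the circle
  and along the fibre.
\<close>

definition partially_differentiable :: "(real \<times> real \<Rightarrow> real) \<Rightarrow> bool"
  where "partially_differentiable F \<longleftrightarrow>
    (\<forall>s y. (\<lambda>t. F (t, y)) differentiable (at s) \<and> (\<lambda>v. F (s, v)) differentiable (at y))"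

lemma partially_differentiable_DERIV:
  assumes "partially_differentiable F"
  shows "((\<lambda>t. F (t, y)) has_real_derivative deriv (\<lambda>t. F (t, y)) s) (at s)"
    and "((\<lambda>v. F (s, v)) has_real_derivative deriv (\<lambda>v. F (s, v)) y) (at y)"
  using assms by (auto simp: partially_differentiable_def DERIV_deriv_iff_real_differentiable)

lemma inverse_fibre_coordinate:
  fixes y :: real
  defines "w \<equiv> y / sqrt (1 + y\<^sup>2)"
  shows "1 - w\<^sup>2 = 1 / (1 + y\<^sup>2)" and "w / sqrt (1 - w\<^sup>2) = y"
proof -
  have pos: "1 + y\<^sup>2 > 0"
    by (simp add: add_pos_nonneg)
  then show *: "1 - w\<^sup>2 = 1 / (1 + y\<^sup>2)"
    by (simp add: w_def power_divide field_simps)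
  show "w / sqrt (1 - w\<^sup>2) = y"
    unfolding * using pos by (simp add: w_def real_sqrt_divide)
qed

lemma DERIV_sqrt_comp:
  assumes "(g has_real_derivative D) (at x)" "g x > 0"
  shows "((\<lambda>v. sqrt (g v)) has_real_derivative D / (2 * sqrt (g x))) (at x)"
  using DERIV_chain2[where f = sqrt, OF DERIV_real_sqrt[OF assms(2)] assms(1)]
  by (simp add: field_simps)

lemma DERIV_fibre_coordinate:
  fixes y :: real
  defines "w \<equiv> y / sqrt (1 + y\<^sup>2)"
  shows "((\<lambda>v. v / sqrt (1 - v\<^sup>2)) has_real_derivative (1 + y\<^sup>2) * sqrt (1 + y\<^sup>2)) (at w)"
proof -
  define S where "S = sqrt (1 + y\<^sup>2)"
  have S: "S > 0" "S\<^sup>2 = 1 + y\<^sup>2"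
    by (simp_all add: S_def add_pos_nonneg)
  have w: "1 - w\<^sup>2 = 1 / S\<^sup>2" and r: "sqrt (1 - w\<^sup>2) = 1 / S"
    using inverse_fibre_coordinate(1)[of y] S by (simp_all add: w_def S_def real_sqrt_divide)
  have pos: "1 - w\<^sup>2 > 0"
    unfolding w using S(1) by simp
  have "((\<lambda>v. sqrt (1 - v\<^sup>2)) has_real_derivative - w * S) (at w)"
    using DERIV_sqrt_comp[of "\<lambda>v. 1 - v\<^sup>2" "- 2 * w" w] pos
    by (auto intro!: derivative_eq_intros simp: r)
  then have "((\<lambda>v. v / sqrt (1 - v\<^sup>2)) has_real_derivative
      (1 * (1 / S) - w * (- w * S)) / ((1 / S) * (1 / S))) (at w)"
    unfolding r[symmetric] using pos r S
    by (intro DERIV_divide DERIV_ident) auto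
  also have "(1 * (1 / S) - w * (- w * S)) / ((1 / S) * (1 / S)) = S * (1 + w\<^sup>2 * S\<^sup>2)"
    using S(1) by (simp add: field_simps power2_eq_square)
  also have "w\<^sup>2 * S\<^sup>2 = y\<^sup>2"
    using S(1) by (simp add: w_def S_def[symmetric] power_divide)
  finally show ?thesis
    by (simp add: S_def mult.commute)
qed

text \<open>
  The chain rule: each fibre derivative picks up the factor \<open>dy/dw = (1 + y\<^sup>2) sqrt (1 + y\<^sup>2)\<close>, and
  the derivative along the circle picks up none because \<open>y\<close> depends on \<open>w\<close> only.
\<close>

lemma poisson_eq:
  assumes "partially_differentiable F" "partially_differentiable G"
  shows "poisson F G (s, y) = (1 + y\<^sup>2) * sqrt (1 + y\<^sup>2) *
    (deriv (\<lambda>v. F (s, v)) y * deriv (\<lambda>t. G (t, y)) s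
     - deriv (\<lambda>t. F (t, y)) s * deriv (\<lambda>v. G (s, v)) y)"
proof -
  define w where "w = y / sqrt (1 + y\<^sup>2)"
  have wy: "w / sqrt (1 - w\<^sup>2) = y"
    unfolding w_def by (rule inverse_fibre_coordinate)
  have "deriv (\<lambda>v. K (s, v / sqrt (1 - v\<^sup>2))) w =
      deriv (\<lambda>v. K (s, v)) y * ((1 + y\<^sup>2) * sqrt (1 + y\<^sup>2))"
    if "partially_differentiable K" for K
  proof (rule DERIV_imp_deriv)
    have "((\<lambda>v. K (s, v)) has_real_derivative deriv (\<lambda>v. K (s, v)) y) (at (w / sqrt (1 - w\<^sup>2)))"
      unfolding wy using that by (rule partially_differentiable_DERIV)
    from DERIV_chain2[OF this DERIV_fibre_coordinate[of y, folded w_def]]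
    show "((\<lambda>v. K (s, v / sqrt (1 - v\<^sup>2))) has_real_derivative
      deriv (\<lambda>v. K (s, v)) y * ((1 + y\<^sup>2) * sqrt (1 + y\<^sup>2))) (at w)" .
  qed
  note fibre = this[OF assms(1)] this[OF assms(2)]
  show ?thesis
    unfolding poisson_def poisson_sw_def in_w_coord_def in_y_coord_def prod.case
      w_def[symmetric] wy fibre
    by algebra
qed

lemma poisson_antisym: "poisson F G = - poisson G F"
  by (auto simp: poisson_def poisson_sw_def in_y_coord_def)

lemma partially_differentiable_add:
  "partially_differentiable F \<Longrightarrow> partially_differentiable G \<Longrightarrow> partially_differentiable (F + G)"
  by (auto simp: partially_differentiable_def)

lemma partially_differentiable_scaleR:
  "partially_differentiable F \<Longrightarrow> partially_differentiable (c *\<^sub>R F)"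
  by (auto simp: partially_differentiable_def scaleR_fun_def)

lemma poisson_add_left:
  assumes "partially_differentiable F" "partially_differentiable F'" "partially_differentiable G"
  shows "poisson (F + F') G = poisson F G + poisson F' G"
proof
  fix p :: "real \<times> real"
  obtain s y where p: "p = (s, y)" by fastforce
  have d: "deriv (\<lambda>t. (F + F') (t, y)) s = deriv (\<lambda>t. F (t, y)) s + deriv (\<lambda>t. F' (t, y)) s"
    "deriv (\<lambda>v. (F + F') (s, v)) y = deriv (\<lambda>v. F (s, v)) y + deriv (\<lambda>v. F' (s, v)) y"
    by (simp_all add: DERIV_imp_deriv DERIV_add partially_differentiable_DERIV assms)
  show "poisson (F + F') G p = (poisson F G + poisson F' G) p"
    unfolding p plus_fun_apply[of "poisson F G"]
      poisson_eq[OF partially_differentiable_add[OF assms(1,2)] assms(3)]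
      poisson_eq[OF assms(1,3)] poisson_eq[OF assms(2,3)] d
    by (simp add: ring_distribs)
qed

lemma poisson_scaleR_left:
  assumes "partially_differentiable F" "partially_differentiable G"
  shows "poisson (c *\<^sub>R F) G = c *\<^sub>R poisson F G"
proof
  fix p :: "real \<times> real"
  obtain s y where p: "p = (s, y)" by fastforce
  have d: "deriv (\<lambda>t. (c *\<^sub>R F) (t, y)) s = c * deriv (\<lambda>t. F (t, y)) s"
    "deriv (\<lambda>v. (c *\<^sub>R F) (s, v)) y = c * deriv (\<lambda>v. F (s, v)) y"
    by (simp_all add: DERIV_imp_deriv DERIV_cmult partially_differentiable_DERIV assms scaleR_fun_def)
  show "poisson (c *\<^sub>R F) G p = (c *\<^sub>R poisson F G) p"
    unfolding p scaleR_fun_def[of c "poisson F G"] real_scaleR_def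
      poisson_eq[OF partially_differentiable_scaleR[OF assms(1)] assms(2)] poisson_eq[OF assms] d
    by (simp add: ring_distribs)
qed

lemma poisson_zero_left: "poisson 0 G = 0"
  by (auto simp: poisson_def poisson_sw_def in_y_coord_def in_w_coord_def fun_eq_iff)

lemma H_add: "H d (\<lambda>s. f s + g s) = H d f + H d g"
  by (auto simp: H_def fun_eq_iff algebra_simps add_divide_distrib)

lemma H_cmult: "H d (\<lambda>s. c * f s) = c *\<^sub>R H d f"
  by (auto simp: H_def fun_eq_iff scaleR_fun_def)

lemma H_zero [simp]: "H d (\<lambda>s. 0) = 0"
  by (auto simp: H_def fun_eq_iff)

lemma H_DERIV_base:
  assumes "(h has_real_derivative h') (at s)"
  shows "((\<lambda>t. H d h (t, y)) has_real_derivative h' * y ^ d / sqrt (1 + y\<^sup>2)) (at s)"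
  unfolding H_def prod.case by (intro DERIV_cdivide DERIV_cmult_right assms)

text \<open>
  The denominator is the factor \<open>dy/dw\<close>, so it cancels in the bracket and leaves two monomials.
  For \<open>d = 0\<close> the truncated exponent \<open>d - 1\<close> is harmless because its coefficient is zero.
\<close>

lemma H_DERIV_fibre:
  "((\<lambda>v. H d h (s, v)) has_real_derivative
    h s * (real d * y ^ (d - 1) + (real d - 1) * y ^ (d + 1)) / ((1 + y\<^sup>2) * sqrt (1 + y\<^sup>2))) (at y)"
proof -
  define S where "S = sqrt (1 + y\<^sup>2)"
  have pos: "1 + y\<^sup>2 > 0"
    by (simp add: add_pos_nonneg)
  then have S: "S > 0" "1 + y\<^sup>2 = S\<^sup>2"
    by (simp_all add: S_def)
  have "((\<lambda>v. 1 + v\<^sup>2) has_real_derivative 2 * y) (at y)"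
    by (auto intro!: derivative_eq_intros)
  then have dS: "((\<lambda>v. sqrt (1 + v\<^sup>2)) has_real_derivative y / S) (at y)"
    using DERIV_sqrt_comp[of "\<lambda>v. 1 + v\<^sup>2" "2 * y" y] pos by (simp add: S_def)
  have "((\<lambda>v. h s * v ^ d) has_real_derivative h s * (real d * y ^ (d - 1))) (at y)"
    by (auto intro!: derivative_eq_intros)
  from DERIV_divide[OF this dS]
  have "((\<lambda>v. H d h (s, v)) has_real_derivative
      (h s * (real d * y ^ (d - 1)) * S - h s * y ^ d * (y / S)) / (S * S)) (at y)"
    using S(1) by (simp add: H_def S_def)
  also have "(h s * (real d * y ^ (d - 1)) * S - h s * y ^ d * (y / S)) / (S * S) =
      h s * (real d * y ^ (d - 1) * S\<^sup>2 - y ^ d * y) / (S\<^sup>2 * S)"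
    using S(1) by (simp add: field_simps power2_eq_square)
  also have "real d * y ^ (d - 1) * S\<^sup>2 - y ^ d * y =
      real d * y ^ (d - 1) + (real d - 1) * y ^ (d + 1)"
    unfolding S(2)[symmetric] by (cases d) (simp_all add: algebra_simps power2_eq_square)
  finally show ?thesis
    unfolding S(2)[symmetric] unfolding S_def .
qed

lemma partially_differentiable_H: "h \<in> smooth_circle \<Longrightarrow> partially_differentiable (H d h)"
  unfolding partially_differentiable_def real_differentiable_def
  using H_DERIV_base H_DERIV_fibre smooth_DERIV by blast

text \<open>
  For \<open>d = e = 0\<close> the truncated degree \<open>d + e - 1\<close> carries the zero coefficient.
\<close>

lemma poisson_H:
  assumes "f \<in> smooth_circle" "g \<in> smooth_circle"
  shows "poisson (H d f) (H e g) =
    H (d + e - 1) (\<lambda>s. real d * (f s * deriv g s) - real e * (deriv f s * g s)) +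
    H (d + e + 1) (\<lambda>s. (real d - 1) * (f s * deriv g s) - (real e - 1) * (deriv f s * g s))"
proof
  fix p :: "real \<times> real"
  obtain s y where p: "p = (s, y)" by fastforce
  define S where "S = sqrt (1 + y\<^sup>2)"
  have S: "S \<noteq> 0" "1 + y\<^sup>2 = S\<^sup>2" "sqrt (S\<^sup>2) = S"
    by (simp_all add: S_def add_nonneg_eq_0_iff)
  have cancel: "S\<^sup>2 * S * (a * X / (S\<^sup>2 * S) * (b * Y / S) - c * Z / S * (k * W / (S\<^sup>2 * S))) =
      (a * b * (X * Y) - c * k * (W * Z)) / S" for a b c k X Y Z W
    using S(1) by (simp add: field_simps)
  \<comment> \<open>For \<open>k = 0\<close> both sides vanish, so the truncated exponents do no harm.\<close>
  have low: "real k * (y ^ (k - 1) * y ^ l) = real k * y ^ (k + l - 1)" for k l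
    by (cases k) (simp_all add: power_add)
  have "poisson (H d f) (H e g) p = S\<^sup>2 * S *
     (f s * (real d * y ^ (d - 1) + (real d - 1) * y ^ (d + 1)) / (S\<^sup>2 * S) *
        (deriv g s * y ^ e / S)
      - deriv f s * y ^ d / S *
        (g s * (real e * y ^ (e - 1) + (real e - 1) * y ^ (e + 1)) / (S\<^sup>2 * S)))"
    unfolding p by (subst poisson_eq)
      (simp_all only: partially_differentiable_H assms DERIV_imp_deriv[OF H_DERIV_fibre]
        DERIV_imp_deriv[OF H_DERIV_base[OF smooth_DERIV]] S(2,3))
  also have "\<dots> =
     ((f s * deriv g s) * (real d * (y ^ (d - 1) * y ^ e) + (real d - 1) * (y ^ (d + 1) * y ^ e))
      - (deriv f s * g s) * (real e * (y ^ (e - 1) * y ^ d) + (real e - 1) * (y ^ (e + 1) * y ^ d))) / S"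
    unfolding cancel by (simp add: ring_distribs mult.assoc)
  also have "\<dots> =
     ((f s * deriv g s) * (real d * y ^ (d + e - 1) + (real d - 1) * y ^ (d + e + 1))
      - (deriv f s * g s) * (real e * y ^ (d + e - 1) + (real e - 1) * y ^ (d + e + 1))) / S"
    unfolding low by (simp add: power_add ac_simps)
  also have "\<dots> = (H (d + e - 1) (\<lambda>s. real d * (f s * deriv g s) - real e * (deriv f s * g s)) +
    H (d + e + 1) (\<lambda>s. (real d - 1) * (f s * deriv g s) - (real e - 1) * (deriv f s * g s))) p"
    by (simp add: p H_def S_def diff_divide_distrib add_divide_distrib algebra_simps)
  finally show "poisson (H d f) (H e g) p =
   (H (d + e - 1) (\<lambda>s. real d * (f s * deriv g s) - real e * (deriv f s * g s)) +
    H (d + e + 1) (\<lambda>s. (real d - 1) * (f s * deriv g s) - (real e - 1) * (deriv f s * g s))) p" .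
qed

section \<open>The summands\<close>

abbreviation summands :: "summand set"
  where "summands \<equiv> {Full 1} \<union> {Full (2 * m) | m. True} \<union>
    {Zero_Mean (2 * m + 1) | m. m \<ge> 1} \<union> {Extra}"

lemma Lam0_iff: "F \<in> Lam0 d \<longleftrightarrow> (\<exists>h. F = H d h \<and> h \<in> smooth_circle \<and> mean h = 0)"
  by (auto simp: Lam0_def mean_eq_0_iff)

lemma H_in_Lam0: "h \<in> smooth_circle \<Longrightarrow> mean h = 0 \<Longrightarrow> H d h \<in> Lam0 d"
  by (auto simp: Lam0_iff)

lemma subspace_Lam: "subspace (Lam d)"
proof (rule subspaceI)
  have "H d (\<lambda>s. 0) \<in> Lam d"
    unfolding Lam_def using smooth_const[of 0] by blast
  then show "0 \<in> Lam d"
    by simp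
next
  fix F G assume "F \<in> Lam d" "G \<in> Lam d"
  then obtain f g where "F = H d f" "G = H d g" "f \<in> smooth_circle" "g \<in> smooth_circle"
    unfolding Lam_def by blast
  then show "F + G \<in> Lam d"
    unfolding Lam_def mem_Collect_eq
    by (intro exI[of _ "\<lambda>s. f s + g s"]) (simp add: H_add smooth_add)
next
  fix c F assume "F \<in> Lam d"
  then obtain f where "F = H d f" "f \<in> smooth_circle"
    unfolding Lam_def by blast
  then show "c *\<^sub>R F \<in> Lam d"
    unfolding Lam_def mem_Collect_eq
    by (intro exI[of _ "\<lambda>s. c * f s"]) (simp add: H_cmult smooth_cmult)
qed

lemma subspace_Lam0: "subspace (Lam0 d)"
proof (rule subspaceI)
  show "0 \<in> Lam0 d"
    unfolding Lam0_iff by (intro exI[of _ "\<lambda>s. 0"]) (simp add: smooth_const)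
next
  fix F G assume "F \<in> Lam0 d" "G \<in> Lam0 d"
  then obtain f g where "F = H d f" "G = H d g" "f \<in> smooth_circle" "g \<in> smooth_circle"
    "mean f = 0" "mean g = 0"
    unfolding Lam0_iff by blast
  then show "F + G \<in> Lam0 d"
    unfolding Lam0_iff
    by (intro exI[of _ "\<lambda>s. f s + g s"]) (simp add: H_add smooth_add mean_add)
next
  fix c F assume "F \<in> Lam0 d"
  then obtain f where "F = H d f" "f \<in> smooth_circle" "mean f = 0"
    unfolding Lam0_iff by blast
  then show "c *\<^sub>R F \<in> Lam0 d"
    unfolding Lam0_iff
    by (intro exI[of _ "\<lambda>s. c * f s"]) (simp add: H_cmult mean_cmult smooth_cmult)
qed

text \<open>
  The derivative of \<open>x\<^sup>j\<close> at \<open>-1\<close>. At \<open>j = 0\<close> the factor \<open>j\<close> makes the truncated exponent harmless.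
\<close>

definition alternating_weight :: "nat \<Rightarrow> real"
  where "alternating_weight j = real j * (- 1) ^ (j - 1)"

lemma deriv_sum_at_minus_one:
  "deriv (\<lambda>x::real. \<Sum>j=1..k. a j * x ^ j) (- 1) = (\<Sum>j=1..k. a j * alternating_weight j)"
  by (rule DERIV_imp_deriv, unfold alternating_weight_def)
    (rule DERIV_sum, auto intro!: derivative_eq_intros)

lemma sum_apply: "(\<Sum>i\<in>A. F i) x = (\<Sum>i\<in>A. F i x)"
  by (induction A rule: infinite_finite_induct) auto

lemma Psi_element_eq:
  "(\<lambda>(s, y). (\<Sum>j=1..k. a j * y ^ (2 * j + 1)) / sqrt (1 + y\<^sup>2)) =
    (\<Sum>j=1..k. a j *\<^sub>R H (2 * j + 1) (\<lambda>s. 1))"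
  by (auto simp: fun_eq_iff sum_apply H_def scaleR_fun_def sum_divide_distrib)

lemma Psi_iff:
  "F \<in> Psi \<longleftrightarrow> (\<exists>k a. F = (\<Sum>j=1..k. a j *\<^sub>R H (2 * j + 1) (\<lambda>s. 1)) \<and>
    (\<Sum>j=1..k. a j * alternating_weight j) = 0)"
  unfolding Psi_def deriv_sum_at_minus_one Psi_element_eq by blast

lemma PsiI:
  assumes "F = (\<Sum>j=1..k. a j *\<^sub>R H (2 * j + 1) (\<lambda>s. 1))"
    and "(\<Sum>j=1..k. a j * alternating_weight j) = 0"
  shows "F \<in> Psi"
  using assms unfolding Psi_iff by blast

lemma sum_pad:
  fixes f :: "nat \<Rightarrow> 'a::comm_monoid_add"
  assumes "k \<le> N"
  shows "(\<Sum>j=1..N. if j \<le> k then f j else 0) = (\<Sum>j=1..k. f j)"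
proof -
  have "{1..N} \<inter> {j. j \<le> k} = {1..k}" using assms by auto
  then show ?thesis
    by (simp add: sum.If_cases)
qed

text \<open>
  Elements of \<open>Psi\<close> come with a degree bound; raising it to a common value makes them addable.
\<close>

lemma Psi_pad:
  assumes "F \<in> Psi"
  shows "\<exists>k. \<forall>N\<ge>k. \<exists>a. F = (\<Sum>j=1..N. a j *\<^sub>R H (2 * j + 1) (\<lambda>s. 1)) \<and>
    (\<Sum>j=1..N. a j * alternating_weight j) = 0"
proof -
  obtain k a where F: "F = (\<Sum>j=1..k. a j *\<^sub>R H (2 * j + 1) (\<lambda>s. 1))"
    and a: "(\<Sum>j=1..k. a j * alternating_weight j) = 0"
    using assms unfolding Psi_iff by blast
  show ?thesis
  proof (intro exI[of _ k] allI impI exI conjI)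
    fix N assume N: "k \<le> N"
    let ?a = "\<lambda>j. if j \<le> k then a j else 0"
    show "F = (\<Sum>j=1..N. ?a j *\<^sub>R H (2 * j + 1) (\<lambda>s. 1))"
      unfolding F sum_pad[OF N, symmetric] by (rule sum.cong) auto
    have "(\<Sum>j=1..N. ?a j * alternating_weight j) = (\<Sum>j=1..k. a j * alternating_weight j)"
      unfolding sum_pad[OF N, symmetric] by (rule sum.cong) auto
    then show "(\<Sum>j=1..N. ?a j * alternating_weight j) = 0"
      using a by (rule trans)
  qed
qed

lemma subspace_Psi: "subspace Psi"
proof (rule subspaceI)
  show "0 \<in> Psi"
    unfolding Psi_iff by (intro exI[of _ 0]) simp
next
  fix F G assume "F \<in> Psi" "G \<in> Psi"
  from this[THEN Psi_pad] obtain k l where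
    kl: "\<forall>N\<ge>k. \<exists>a. F = (\<Sum>j=1..N. a j *\<^sub>R H (2 * j + 1) (\<lambda>s. 1)) \<and>
      (\<Sum>j=1..N. a j * alternating_weight j) = 0"
    "\<forall>N\<ge>l. \<exists>a. G = (\<Sum>j=1..N. a j *\<^sub>R H (2 * j + 1) (\<lambda>s. 1)) \<and>
      (\<Sum>j=1..N. a j * alternating_weight j) = 0"
    by auto
  let ?N = "max k l"
  obtain a b where
    "F = (\<Sum>j=1..?N. a j *\<^sub>R H (2 * j + 1) (\<lambda>s. 1))" "(\<Sum>j=1..?N. a j * alternating_weight j) = 0"
    "G = (\<Sum>j=1..?N. b j *\<^sub>R H (2 * j + 1) (\<lambda>s. 1))" "(\<Sum>j=1..?N. b j * alternating_weight j) = 0"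
    using kl(1)[rule_format, of ?N] kl(2)[rule_format, of ?N] by auto
  then show "F + G \<in> Psi"
    unfolding Psi_iff
    by (intro exI[of _ ?N] exI[of _ "\<lambda>j. a j + b j"])
      (simp add: scaleR_add_left distrib_right sum.distrib)
next
  fix c F assume "F \<in> Psi"
  then obtain k a where F: "F = (\<Sum>j=1..k. a j *\<^sub>R H (2 * j + 1) (\<lambda>s. 1))"
    and a: "(\<Sum>j=1..k. a j * alternating_weight j) = 0"
    unfolding Psi_iff by blast
  have "c *\<^sub>R F = (\<Sum>j=1..k. (c * a j) *\<^sub>R H (2 * j + 1) (\<lambda>s. 1))"
    unfolding F scaleR_sum_right scaleR_scaleR ..
  moreover have "(\<Sum>j=1..k. (c * a j) * alternating_weight j) = 0"
    unfolding mult.assoc sum_distrib_left[symmetric] a by simp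
  ultimately show "c *\<^sub>R F \<in> Psi"
    by (rule PsiI)
qed

lemma subspace_summand_space: "subspace (summand_space i)"
  by (cases i) (simp_all add: subspace_Lam subspace_Lam0 subspace_Psi)

text \<open>
  In the variable \<open>x\<close> this is \<open>(j + 1) x\<^sup>j + j x\<^bsup>j+1\<^esup>\<close>, with derivative \<open>j (j + 1) x\<^bsup>j-1\<^esup> (1 + x)\<close>.
\<close>

lemma Psi_generator:
  assumes "j \<ge> 1"
  shows "real (j + 1) *\<^sub>R H (2 * j + 1) (\<lambda>s. 1) + real j *\<^sub>R H (2 * j + 3) (\<lambda>s. 1) \<in> Psi"
proof -
  let ?a = "\<lambda>i. if i = j then real (j + 1) else if i = Suc j then real j else 0"
  obtain m where j: "j = Suc m" using assms by (cases j) auto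
  have upper: "{1..Suc j} = insert (Suc j) (insert j {1..m})" by (auto simp: j)
  have top: "2 * Suc j + 1 = 2 * j + 3" by simp
  have zero: "(\<Sum>i=1..m. ?a i *\<^sub>R H (2 * i + 1) (\<lambda>s. 1)) = 0"
    "(\<Sum>i=1..m. ?a i * alternating_weight i) = 0"
    by (auto intro!: sum.neutral simp: j)
  have split: "sum F {1..Suc j} = F (Suc j) + (F j + sum F {1..m})"
    for F :: "nat \<Rightarrow> 'a::comm_monoid_add"
    unfolding upper by (simp add: j)
  have "real (j + 1) *\<^sub>R H (2 * j + 1) (\<lambda>s. 1) + real j *\<^sub>R H (2 * j + 3) (\<lambda>s. 1) =
      (\<Sum>i=1..Suc j. ?a i *\<^sub>R H (2 * i + 1) (\<lambda>s. 1))"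
    unfolding split zero top by (simp add: add.commute)
  moreover have "(\<Sum>i=1..Suc j. ?a i * alternating_weight i) = 0"
    unfolding split zero by (simp add: j alternating_weight_def)
  ultimately show ?thesis
    by (rule PsiI)
qed

text \<open>
  Two families indexed by different finite sets are added after extending both by zero to the
  union of the index sets.
\<close>

lemma span_Union_subspaces:
  fixes V :: "'i \<Rightarrow> 'v::real_vector set"
  assumes "\<And>i. i \<in> I \<Longrightarrow> subspace (V i)"
  shows "span (\<Union>i\<in>I. V i) =
    {(\<Sum>i\<in>J. v i) | J v. finite J \<and> J \<subseteq> I \<and> (\<forall>i\<in>J. v i \<in> V i)}" (is "_ = ?S")
proof
  have sub: "subspace ?S"
  proof (rule subspaceI)
    show "0 \<in> ?S"
      by (intro CollectI exI[of _ "{}"]) simp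
  next
    fix x y assume "x \<in> ?S" "y \<in> ?S"
    then obtain J v K w where
      x: "x = (\<Sum>i\<in>J. v i)" "finite J" "J \<subseteq> I" "\<forall>i\<in>J. v i \<in> V i" and
      y: "y = (\<Sum>i\<in>K. w i)" "finite K" "K \<subseteq> I" "\<forall>i\<in>K. w i \<in> V i"
      by blast
    let ?u = "\<lambda>i. (if i \<in> J then v i else 0) + (if i \<in> K then w i else 0)"
    have "x + y = (\<Sum>i\<in>J\<union>K. ?u i)"
      unfolding x(1) y(1) sum.distrib using x(2) y(2)
      by (intro arg_cong2[where f = "(+)"] sum.mono_neutral_cong_left) auto
    moreover have "\<forall>i\<in>J\<union>K. ?u i \<in> V i"
      using x y assms by (auto intro!: subspace_add intro: subspace_0)
    ultimately show "x + y \<in> ?S"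
      using x(2,3) y(2,3) by (intro CollectI exI[of _ "J \<union> K"] exI[of _ ?u]) auto
  next
    fix c x assume "x \<in> ?S"
    then obtain J v where x: "x = (\<Sum>i\<in>J. v i)" "finite J" "J \<subseteq> I" "\<forall>i\<in>J. v i \<in> V i"
      by blast
    then show "c *\<^sub>R x \<in> ?S"
      using assms by (intro CollectI exI[of _ J] exI[of _ "\<lambda>i. c *\<^sub>R v i"])
        (auto simp: scaleR_sum_right intro!: subspace_scale)
  qed
  show "span (\<Union>i\<in>I. V i) \<subseteq> ?S"
  proof (rule span_minimal[OF _ sub], rule UN_least, rule subsetI)
    fix i x assume "i \<in> I" "x \<in> V i"
    then show "x \<in> ?S"
      by (intro CollectI exI[of _ "{i}"] exI[of _ "\<lambda>_. x"]) simp
  qed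
  show "?S \<subseteq> span (\<Union>i\<in>I. V i)"
    by (auto intro!: span_sum intro: span_base)
qed

section \<open>The span of the summands is closed under the bracket\<close>

lemma H_minus_mean_in_Lam0:
  assumes "h \<in> smooth_circle"
  obtains F where "F \<in> Lam0 d" "H d h = F + mean h *\<^sub>R H d (\<lambda>s. 1)"
proof
  show "H d (\<lambda>s. h s - mean h) \<in> Lam0 d"
    unfolding Lam0_iff using assms mean_diff[OF assms smooth_const[of "mean h"]]
    by (intro exI[of _ "\<lambda>s. h s - mean h"]) (simp add: smooth_diff smooth_const)
  show "H d h = H d (\<lambda>s. h s - mean h) + mean h *\<^sub>R H d (\<lambda>s. 1)"
    by (simp flip: H_add H_cmult)
qed

definition target_space :: "(real \<times> real \<Rightarrow> real) set"
  where "target_space = span (\<Union>i\<in>summands. summand_space i)"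

lemma subspace_target_space: "subspace target_space"
  by (simp add: target_space_def)

lemma summand_in_target:
  "F \<in> Lam 1 \<Longrightarrow> F \<in> target_space"
  "F \<in> Lam d \<Longrightarrow> even d \<Longrightarrow> F \<in> target_space"
  "F \<in> Lam0 d \<Longrightarrow> odd d \<Longrightarrow> d \<ge> 3 \<Longrightarrow> F \<in> target_space"
  "F \<in> Psi \<Longrightarrow> F \<in> target_space"
proof -
  have *: "F \<in> summand_space i \<Longrightarrow> i \<in> summands \<Longrightarrow> F \<in> target_space" for F i
    unfolding target_space_def by (rule span_base) blast
  show "F \<in> Lam 1 \<Longrightarrow> F \<in> target_space"
    using *[of F "Full 1"] by simp
  show "F \<in> Psi \<Longrightarrow> F \<in> target_space"
    using *[of F Extra] by simp
  show "F \<in> Lam d \<Longrightarrow> even d \<Longrightarrow> F \<in> target_space"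
    using *[of F "Full d"] by auto
  show "F \<in> Lam0 d \<Longrightarrow> odd d \<Longrightarrow> d \<ge> 3 \<Longrightarrow> F \<in> target_space"
    using *[of F "Zero_Mean d"] by (auto elim!: oddE)
qed

text \<open>
  If \<open>d + e\<close> is odd, both parts have even degree and there is nothing to check. If it is even
  and positive, the zero-mean parts of the two coefficients lie in the odd summands, and the means
  \<open>(d + e) m\<close> and \<open>(d + e - 2) m\<close> combine to a multiple of a generator of \<open>Psi\<close>, except for
  \<open>d + e = 2\<close>, where degree \<open>1\<close> is free and the mean in degree \<open>3\<close> vanishes.
\<close>

lemma poisson_H_in_target:
  assumes "f \<in> smooth_circle" "g \<in> smooth_circle"
  shows "poisson (H d f) (H e g) \<in> target_space"
proof -
  define a where "a = (\<lambda>s. real d * (f s * deriv g s) - real e * (deriv f s * g s))"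
  define b where "b = (\<lambda>s. (real d - 1) * (f s * deriv g s) - (real e - 1) * (deriv f s * g s))"
  define m where "m = mean (\<lambda>s. f s * deriv g s)"
  have sm: "(\<lambda>s. f s * deriv g s) \<in> smooth_circle" "(\<lambda>s. deriv f s * g s) \<in> smooth_circle"
    using assms by (auto intro: smooth_mult smooth_deriv)
  have ab: "a \<in> smooth_circle" "b \<in> smooth_circle"
    unfolding a_def b_def by (intro smooth_diff smooth_cmult sm)+
  have m': "mean (\<lambda>s. deriv f s * g s) = - m"
    unfolding m_def by (rule mean_by_parts) fact+
  have ma: "mean a = real (d + e) * m" and mb: "mean b = (real (d + e) - 2) * m"
    unfolding a_def b_def mean_diff[OF smooth_cmult[OF sm(1)] smooth_cmult[OF sm(2)]] mean_cmult
      m_def[symmetric] m'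
    by (simp_all add: algebra_simps)
  have br: "poisson (H d f) (H e g) = H (d + e - 1) a + H (d + e + 1) b"
    unfolding a_def b_def by (rule poisson_H) fact+
  have Lam_ab: "H n a \<in> Lam n" "H n b \<in> Lam n" for n
    using ab by (auto simp: Lam_def)
  note add = subspace_add[OF subspace_target_space]
  consider "odd (d + e)" | "d + e = 0" | "d + e = 2" | j where "d + e = 2 * (j + 1)" "j \<ge> 1"
  proof (cases "odd (d + e)")
    case False
    then obtain n where n: "d + e = 2 * n" by blast
    show ?thesis
    proof (cases "n \<ge> 2")
      case True
      then show ?thesis using n that(4)[of "n - 1"] by simp
    next
      case False
      then have "n = 0 \<or> n = 1" by auto
      then show ?thesis using n that(2,3) by auto
    qed
  qed (use that(1) in blast)
  then show ?thesis
  proof cases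
    case 1
    then have "even (d + e - 1)" "even (d + e + 1)" by auto
    then show ?thesis
      unfolding br using Lam_ab by (intro add summand_in_target(2)) auto
  next
    case 2
    then have "a = (\<lambda>s. 0)" "d + e + 1 = 1" by (auto simp: a_def)
    then show ?thesis
      unfolding br using summand_in_target(1)[OF Lam_ab(2)] by simp
  next
    case 3
    then have 1: "d + e - 1 = 1" and 2: "d + e + 1 = 3" by auto
    have "mean b = 0" unfolding mb 3 by simp
    then have "H 3 b \<in> target_space"
      using ab by (intro summand_in_target(3)[of _ 3]) (auto simp: Lam0_iff)
    then show ?thesis
      unfolding br 1 2 by (intro add summand_in_target(1)[OF Lam_ab(1)])
  next
    case 4
    then have 1: "d + e - 1 = 2 * j + 1" and 2: "d + e + 1 = 2 * j + 3" by auto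
    obtain F where F: "F \<in> Lam0 (2 * j + 1)"
      "H (2 * j + 1) a = F + mean a *\<^sub>R H (2 * j + 1) (\<lambda>s. 1)"
      using H_minus_mean_in_Lam0[OF ab(1)] .
    obtain G where G: "G \<in> Lam0 (2 * j + 3)"
      "H (2 * j + 3) b = G + mean b *\<^sub>R H (2 * j + 3) (\<lambda>s. 1)"
      using H_minus_mean_in_Lam0[OF ab(2)] .
    let ?E = "real (j + 1) *\<^sub>R H (2 * j + 1) (\<lambda>s. 1) + real j *\<^sub>R H (2 * j + 3) (\<lambda>s. 1)"
    have m: "mean a = (2 * m) * real (j + 1)" "mean b = (2 * m) * real j"
      unfolding ma mb 4(1) by (simp_all add: algebra_simps)
    have "poisson (H d f) (H e g) = F + G + (2 * m) *\<^sub>R ?E"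
      unfolding br 1 2 F(2) G(2) m scaleR_add_right scaleR_scaleR by (simp add: algebra_simps)
    moreover have "F \<in> target_space" "G \<in> target_space"
      using 4(2) F(1) G(1) by (auto intro: summand_in_target(3))
    moreover have "?E \<in> target_space"
      using 4(2) by (intro summand_in_target(4) Psi_generator)
    ultimately show ?thesis
      using add subspace_scale[OF subspace_target_space] by metis
  qed
qed

text \<open>
  Bilinearity is applied over this larger span: it contains \<open>Psi\<close>, and the formula
  for \<open>{H d f, H e g}\<close> covers all pairs of its generators.
\<close>

definition all_H_span :: "(real \<times> real \<Rightarrow> real) set"
  where "all_H_span = span {H d h | d h. h \<in> smooth_circle}"

lemma partially_differentiable_zero: "partially_differentiable 0"
  by (simp add: partially_differentiable_def)

lemma partially_differentiable_all_H_span: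
  assumes "F \<in> all_H_span"
  shows "partially_differentiable F"
  using assms unfolding all_H_span_def
proof (induction rule: span_induct_alt)
  case base
  show ?case by (rule partially_differentiable_zero)
next
  case (step c x y)
  then obtain d h where "x = H d h" "h \<in> smooth_circle" by blast
  then have "partially_differentiable x" by (simp add: partially_differentiable_H)
  then show ?case
    using step.IH by (intro partially_differentiable_add partially_differentiable_scaleR)
qed

lemma target_space_subset: "target_space \<subseteq> all_H_span"
proof -
  have H: "H d h \<in> all_H_span" if "h \<in> smooth_circle" for d h
    unfolding all_H_span_def using that by (intro span_base) blast
  have "subspace all_H_span" by (simp add: all_H_span_def)
  moreover have "summand_space i \<subseteq> all_H_span" for i
  proof (cases i)
    case Extra
    have "(\<Sum>j=1..k. a j *\<^sub>R H (2 * j + 1) (\<lambda>s. 1)) \<in> all_H_span" for k a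
      by (intro subspace_sum[OF \<open>subspace all_H_span\<close>] subspace_scale[OF \<open>subspace all_H_span\<close>]
          H smooth_const)
    then show ?thesis
      using Extra by (auto simp: Psi_iff)
  qed (use H in \<open>auto simp: Lam_def Lam0_def\<close>)
  ultimately show ?thesis
    unfolding target_space_def by (intro span_minimal UN_least)
qed

text \<open>
  Linearity is needed in the first argument only: antisymmetry, which holds for arbitrary
  functions, transfers it to the second.
\<close>

lemma poisson_in_target:
  assumes "F \<in> all_H_span" "G \<in> all_H_span"
  shows "poisson F G \<in> target_space"
proof -
  let ?T = target_space
  note pd = partially_differentiable_all_H_span
  have left: "poisson F G \<in> ?T"
    if F: "F \<in> all_H_span" and G: "G \<in> all_H_span"
      and gen: "\<And>d h. h \<in> smooth_circle \<Longrightarrow> poisson (H d h) G \<in> ?T" for F G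
  proof -
    have "F \<in> span {H d h | d h. h \<in> smooth_circle}"
      using F by (simp add: all_H_span_def)
    then have "partially_differentiable F \<and> poisson F G \<in> ?T"
    proof (induction rule: span_induct_alt)
      case base
      show ?case
        unfolding poisson_zero_left
        by (intro conjI partially_differentiable_zero subspace_0 subspace_target_space)
    next
      case (step c x y)
      then obtain d h where x: "x = H d h" "h \<in> smooth_circle" by blast
      then have px: "partially_differentiable x" by (simp add: partially_differentiable_H)
      have "poisson (c *\<^sub>R x + y) G = c *\<^sub>R poisson x G + poisson y G"
        using step px pd[OF G]
        by (simp add: poisson_add_left poisson_scaleR_left partially_differentiable_scaleR)
      moreover have "poisson x G \<in> ?T" using gen x by simp
      then have "c *\<^sub>R poisson x G + poisson y G \<in> ?T"
        using step.IH by (intro subspace_add subspace_scale subspace_target_space) auto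
      moreover have "partially_differentiable (c *\<^sub>R x + y)"
        using step.IH px by (intro partially_differentiable_add partially_differentiable_scaleR) auto
      ultimately show ?case by argo
    qed
    then show ?thesis ..
  qed
  have H: "H d h \<in> all_H_span" if "h \<in> smooth_circle" for d h
    unfolding all_H_span_def using that by (intro span_base) blast
  have "poisson (H d h) G \<in> ?T" if "h \<in> smooth_circle" for d h
    using left[OF assms(2) H[OF that]] poisson_H_in_target that
      poisson_antisym[of "H d h" G] subspace_neg[OF subspace_target_space] by metis
  then show ?thesis
    using left[OF assms] by blast
qed

abbreviation generated_algebra :: "(real \<times> real \<Rightarrow> real) set"
  where "generated_algebra \<equiv> poisson_lie_algebra {H 0 f | f. f \<in> smooth_circle}"

lemma generated_algebra_subset_target: "generated_algebra \<subseteq> target_space"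
proof
  fix F assume "F \<in> generated_algebra"
  then show "F \<in> target_space"
  proof induction
    case (generator F)
    then show ?case by (intro summand_in_target(2)[of _ 0]) (auto simp: Lam_def)
  next
    case (bracket F G)
    then show ?case using target_space_subset by (intro poisson_in_target) auto
  qed (intro subspace_0 subspace_add subspace_scale subspace_target_space; assumption)+
qed

section \<open>The summands are generated\<close>

lemma subspace_poisson_lie_algebra: "subspace (poisson_lie_algebra S)"
  by (rule subspaceI) (fact poisson_lie_algebra.intros)+

lemmas generated_add = subspace_add[OF subspace_poisson_lie_algebra]
  and generated_diff = subspace_diff[OF subspace_poisson_lie_algebra]
  and generated_scale = subspace_scale[OF subspace_poisson_lie_algebra]

lemma Lam0_subset_Lam: "Lam0 d \<subseteq> Lam d"
  by (auto simp: Lam0_def Lam_def)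

text \<open>
  The zero-mean functions form a hyperplane, so a single function outside it suffices.
\<close>

lemma Lam_subsetI_nonzero_mean:
  assumes L: "subspace L" "Lam0 d \<subseteq> L"
    and u: "u \<in> smooth_circle" "mean u \<noteq> 0" "H d u \<in> L"
  shows "Lam d \<subseteq> L"
proof
  fix F assume "F \<in> Lam d"
  then obtain h where h: "F = H d h" "h \<in> smooth_circle"
    unfolding Lam_def by blast
  define c where "c = mean h / mean u"
  have "mean (\<lambda>s. h s - c * u s) = 0"
    unfolding mean_diff[OF h(2) smooth_cmult[OF u(1)]] mean_cmult using u(2) by (simp add: c_def)
  then have "H d (\<lambda>s. h s - c * u s) \<in> L"
    by (intro subsetD[OF L(2)] H_in_Lam0 smooth_diff smooth_cmult h(2) u(1))
  moreover have "F = H d (\<lambda>s. h s - c * u s) + c *\<^sub>R H d u"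
    unfolding h(1) H_cmult[symmetric] H_add[symmetric] by simp
  ultimately show "F \<in> L"
    using u(3) L(1) by (metis subspace_add subspace_scale)
qed

lemma bracket_with_generator:
  assumes "f \<in> smooth_circle" "g \<in> smooth_circle" "H e g \<in> generated_algebra"
  shows "H (e - 1) (\<lambda>s. - real e * (deriv f s * g s)) +
    H (e + 1) (\<lambda>s. - (f s * deriv g s) - (real e - 1) * (deriv f s * g s)) \<in> generated_algebra"
proof -
  have "H 0 f \<in> generated_algebra"
    using assms(1) by (intro poisson_lie_algebra.generator) blast
  then have "poisson (H 0 f) (H e g) \<in> generated_algebra"
    using assms(3) by (rule poisson_lie_algebra.bracket)
  then show ?thesis
    unfolding poisson_H[OF assms(1,2)] by simp
qed

text \<open>
  With \<open>f = -1\<close> the bracket \<open>{H 0 f, H e g}\<close> is \<open>H (e + 1) g'\<close>, and every \<open>h\<close> of mean zero is some \<open>g'\<close>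
  with \<open>g\<close> of mean zero again.
\<close>

lemma generated_Lam0_Suc:
  assumes "Lam0 e \<subseteq> generated_algebra"
  shows "Lam0 (e + 1) \<subseteq> generated_algebra"
proof
  fix F assume "F \<in> Lam0 (e + 1)"
  then obtain h where h: "F = H (e + 1) h" "h \<in> smooth_circle" "mean h = 0"
    unfolding Lam0_iff by blast
  obtain g where g: "g \<in> smooth_circle" "mean g = 0" "deriv g = h"
    using zero_mean_primitive[OF h(2,3)] .
  have "H e g \<in> generated_algebra"
    using assms H_in_Lam0[OF g(1,2)] by blast
  from bracket_with_generator[OF smooth_const[of "-1"] g(1) this]
  show "F \<in> generated_algebra"
    by (simp add: g(3) h(1))
qed

lemma mean_cos: "mean cos = 0"
  using mean_deriv[of sin cos] DERIV_sin by simp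

text \<open>
  With \<open>f = sin\<close> and \<open>g = cos\<close>, the function \<open>g\<close> has mean zero, so the bracket is available in odd
  degrees too, whereas \<open>f' g = cos\<^sup>2\<close> has nonzero mean and makes the coefficients leave the
  zero-mean functions.
\<close>

lemma bracket_sin_cos:
  fixes e :: nat
  assumes "Lam0 e \<subseteq> generated_algebra"
  obtains a b where "a \<in> smooth_circle" "b \<in> smooth_circle"
    "mean a = - real e / 2" "mean b = (2 - real e) / 2" "e = 0 \<Longrightarrow> a = (\<lambda>s. 0)"
    "H (e - 1) a + H (e + 1) b \<in> generated_algebra"
proof
  let ?a = "\<lambda>s::real. - real e * (cos s * cos s)"
  let ?b = "\<lambda>s::real. sin s * sin s - (real e - 1) * (cos s * cos s)"
  note sq = smooth_mult[OF smooth_sin smooth_sin] smooth_mult[OF smooth_cos smooth_cos]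
  show "?a \<in> smooth_circle" "?b \<in> smooth_circle"
    by (intro smooth_diff smooth_cmult sq)+
  show "mean ?a = - real e / 2"
    unfolding mean_cmult mean_cos_sq by simp
  show "mean ?b = (2 - real e) / 2"
    unfolding mean_diff[OF sq(1) smooth_cmult[OF sq(2)]] mean_cmult mean_cos_sq mean_sin_sq
    by (simp add: field_simps)
  show "?a = (\<lambda>s. 0)" if "e = 0"
    using that by simp
  have "H e cos \<in> generated_algebra"
    using assms H_in_Lam0[OF smooth_cos mean_cos] by blast
  from bracket_with_generator[OF smooth_sin smooth_cos this]
  show "H (e - 1) ?a + H (e + 1) ?b \<in> generated_algebra"
    by (simp add: deriv_sin_cos)
qed

text \<open>
  The case \<open>e = 2\<close> is a true exception: the top coefficient of \<open>bracket_sin_cos\<close> then has mean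
  zero. It is this gap that keeps degree \<open>3\<close>, and with it the higher odd degrees, from
  being full.
\<close>

lemma generated_Lam_Suc:
  assumes "Lam0 e \<subseteq> generated_algebra" "e = 0 \<or> Lam (e - 1) \<subseteq> generated_algebra" "e \<noteq> 2"
  shows "Lam (e + 1) \<subseteq> generated_algebra"
proof -
  obtain a b where ab: "a \<in> smooth_circle" "b \<in> smooth_circle"
    "mean b = (2 - real e) / 2" "e = 0 \<Longrightarrow> a = (\<lambda>s. 0)"
    "H (e - 1) a + H (e + 1) b \<in> generated_algebra"
    using bracket_sin_cos[OF assms(1)] by blast
  have "H (e - 1) a \<in> generated_algebra"
  proof (cases "e = 0")
    case True
    show ?thesis
      unfolding ab(4)[OF True] H_zero by (rule poisson_lie_algebra.zero)
  next
    case False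
    then show ?thesis
      using assms(2) ab(1) by (auto simp: Lam_def)
  qed
  from generated_diff[OF ab(5) this] have "H (e + 1) b \<in> generated_algebra"
    unfolding add_diff_cancel_left' .
  moreover have "mean b \<noteq> 0"
    using ab(3) assms(3) by auto
  ultimately show ?thesis
    using ab(2) by (intro Lam_subsetI_nonzero_mean subspace_poisson_lie_algebra
        generated_Lam0_Suc assms(1))
qed

text \<open>
  Even degree \<open>2 n + 2\<close> comes from the odd degree \<open>2 n + 1\<close> below it, whose bracket has its lower
  part in degree \<open>2 n\<close>; both are given by the induction hypothesis.
\<close>

lemma generated_Lam_even_Lam0_odd:
  "Lam (2 * n) \<subseteq> generated_algebra \<and> Lam0 (2 * n + 1) \<subseteq> generated_algebra"
proof (induction n)
  case 0
  have "Lam (2 * 0) \<subseteq> generated_algebra"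
    by (auto simp: Lam_def intro!: poisson_lie_algebra.generator)
  then show ?case
    using generated_Lam0_Suc[of "2 * 0"] Lam0_subset_Lam[of "2 * 0"] by blast
next
  case (Suc n)
  have "2 * n + 1 \<noteq> 2" by presburger
  then have "Lam (2 * n + 1 + 1) \<subseteq> generated_algebra"
    using Suc by (intro generated_Lam_Suc) auto
  then have "Lam (2 * Suc n) \<subseteq> generated_algebra" by simp
  then show ?case
    using generated_Lam0_Suc[of "2 * Suc n"] Lam0_subset_Lam[of "2 * Suc n"] by blast
qed

lemma generated_Lam_1: "Lam 1 \<subseteq> generated_algebra"
proof -
  have "Lam0 0 \<subseteq> generated_algebra"
    using generated_Lam_even_Lam0_odd[of 0] Lam0_subset_Lam[of 0] by auto
  from generated_Lam_Suc[OF this] show ?thesis by simp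
qed

text \<open>
  The case \<open>e = 2 (j + 1)\<close> of \<open>bracket_sin_cos\<close>: modulo zero-mean terms, its coefficients are
  their means \<open>- (j + 1)\<close> and \<open>- j\<close>.
\<close>

lemma generated_Psi_generator:
  assumes "j \<ge> 1"
  shows "real (j + 1) *\<^sub>R H (2 * j + 1) (\<lambda>s. 1) + real j *\<^sub>R H (2 * j + 3) (\<lambda>s. 1) \<in> generated_algebra"
proof -
  let ?e = "2 * (j + 1)" and ?one = "\<lambda>s::real. 1::real"
  have "Lam0 ?e \<subseteq> generated_algebra"
    using generated_Lam_even_Lam0_odd[of "j + 1"] Lam0_subset_Lam by blast
  then obtain a b where ab: "a \<in> smooth_circle" "b \<in> smooth_circle"
    "mean a = - real ?e / 2" "mean b = (2 - real ?e) / 2"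
    "H (?e - 1) a + H (?e + 1) b \<in> generated_algebra"
    by (rule bracket_sin_cos)
  have deg: "?e - 1 = 2 * j + 1" "?e + 1 = 2 * j + 3" by simp_all
  have m: "mean a = - real (j + 1)" "mean b = - real j"
    unfolding ab(3,4) by simp_all
  obtain F where F: "F \<in> Lam0 (2 * j + 1)" "H (2 * j + 1) a = F + mean a *\<^sub>R H (2 * j + 1) ?one"
    using H_minus_mean_in_Lam0[OF ab(1)] .
  obtain G where G: "G \<in> Lam0 (2 * j + 3)" "H (2 * j + 3) b = G + mean b *\<^sub>R H (2 * j + 3) ?one"
    using H_minus_mean_in_Lam0[OF ab(2)] .
  have rearrange: "p *\<^sub>R x + q *\<^sub>R y = f + g - ((f + (- p) *\<^sub>R x) + (g + (- q) *\<^sub>R y))"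
    for p q :: real and x y f g :: "'v::real_vector"
    by (simp add: algebra_simps)
  have deg3: "2 * (j + 1) + 1 = 2 * j + 3" by simp
  have "Lam0 (2 * j + 1) \<subseteq> generated_algebra" "Lam0 (2 * j + 3) \<subseteq> generated_algebra"
    using generated_Lam_even_Lam0_odd[of j] generated_Lam_even_Lam0_odd[of "j + 1", unfolded deg3] by blast+
  then have "F \<in> generated_algebra" "G \<in> generated_algebra"
    using F(1) G(1) by blast+
  then have "F + G \<in> generated_algebra"
    by (rule generated_add)
  from generated_diff[OF this ab(5)[unfolded deg F(2) G(2) m]]
  show ?thesis
    unfolding rearrange[of _ _ _ _ F G] .
qed

text \<open>
  Modulo \<open>L\<close>, the relation \<open>(j + 1) x + j z \<equiv> 0\<close> turns \<open>x \<equiv> w\<^sub>j t\<close> into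
  \<open>z \<equiv> - ((j + 1) / j) w\<^sub>j t = w\<^sub>j\<^sub>+\<^sub>1 t\<close>, where \<open>w\<^sub>j\<close> is the derivative of \<open>x\<^sup>j\<close> at \<open>-1\<close>.
\<close>

lemma congruence_step:
  fixes x z t :: "'v::real_vector"
  assumes "subspace L" "real (j + 1) *\<^sub>R x + real j *\<^sub>R z \<in> L" "x - alternating_weight j *\<^sub>R t \<in> L"
    and "j \<ge> 1"
  shows "z - alternating_weight (Suc j) *\<^sub>R t \<in> L"
proof -
  let ?r = "real (j + 1) / real j"
  have w: "alternating_weight (Suc j) = - (?r * alternating_weight j)"
    using assms(4) by (cases j) (auto simp: alternating_weight_def)
  have "(1 / real j) *\<^sub>R (real (j + 1) *\<^sub>R x + real j *\<^sub>R z) - ?r *\<^sub>R (x - alternating_weight j *\<^sub>R t)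
      = ?r *\<^sub>R x + z - (?r *\<^sub>R x - (?r * alternating_weight j) *\<^sub>R t)"
    using assms(4) by (simp add: scaleR_add_right scaleR_diff_right)
  also have "\<dots> = z - alternating_weight (Suc j) *\<^sub>R t"
    unfolding w scaleR_minus_left by (simp add: algebra_simps)
  finally show ?thesis
    using assms(1-3) by (metis subspace_diff subspace_scale)
qed

lemma generated_H_odd_congruence:
  assumes "j \<ge> 1"
  shows "H (2 * j + 1) (\<lambda>s. 1) - alternating_weight j *\<^sub>R H 3 (\<lambda>s. 1) \<in> generated_algebra"
  using assms
proof (induction j rule: dec_induct)
  case base
  have "H (2 * 1 + 1) (\<lambda>s. 1) - alternating_weight 1 *\<^sub>R H 3 (\<lambda>s. 1) = 0"
    by (simp add: alternating_weight_def)
  then show ?case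
    by (metis poisson_lie_algebra.zero)
next
  case (step j)
  have "2 * Suc j + 1 = 2 * j + 3" by simp
  then show ?case
    using congruence_step[OF subspace_poisson_lie_algebra generated_Psi_generator[OF step.hyps(1)]
      step.IH step.hyps(1)] by metis
qed

text \<open>
  By \<open>generated_H_odd_congruence\<close> an odd polynomial without linear term is congruent, modulo the generated algebra, to
  \<open>H 3 1\<close> times the derivative at \<open>-1\<close> that the definition of \<open>Psi\<close> requires to vanish.
\<close>

lemma generated_Psi: "Psi \<subseteq> generated_algebra"
proof
  fix F assume "F \<in> Psi"
  then obtain k a where F: "F = (\<Sum>j=1..k. a j *\<^sub>R H (2 * j + 1) (\<lambda>s. 1))"
    and a: "(\<Sum>j=1..k. a j * alternating_weight j) = 0"
    unfolding Psi_iff by blast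
  let ?t = "H 3 (\<lambda>s. 1)"
  have "(\<Sum>j=1..k. a j *\<^sub>R (H (2 * j + 1) (\<lambda>s. 1) - alternating_weight j *\<^sub>R ?t)) \<in> generated_algebra"
    by (intro subspace_sum[OF subspace_poisson_lie_algebra] generated_scale
        generated_H_odd_congruence) simp
  also have "(\<Sum>j=1..k. a j *\<^sub>R (H (2 * j + 1) (\<lambda>s. 1) - alternating_weight j *\<^sub>R ?t)) =
      F - (\<Sum>j=1..k. a j * alternating_weight j) *\<^sub>R ?t"
    unfolding F scaleR_diff_right sum_subtractf scaleR_scaleR scaleR_sum_left ..
  also have "\<dots> = F"
    unfolding a scaleR_zero_left diff_0_right ..
  finally show "F \<in> generated_algebra" .
qed

lemma target_subset_generated_algebra: "target_space \<subseteq> generated_algebra"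
  unfolding target_space_def
proof (intro span_minimal UN_least subspace_poisson_lie_algebra)
  fix i assume "i \<in> summands"
  then consider "i = Full 1" | m where "i = Full (2 * m)" | m where "i = Zero_Mean (2 * m + 1)"
    | "i = Extra"
    by blast
  then show "summand_space i \<subseteq> generated_algebra"
    using generated_Lam_1 generated_Lam_even_Lam0_odd generated_Psi
    by cases (simp_all only: summand_space.simps)
qed

section \<open>Independence\<close>

text \<open>
  The possible polynomials in \<open>y\<close>, one for each \<open>s\<close>, that remain when the common denominator
  \<open>sqrt (1 + y\<^sup>2)\<close> is cleared; only what separates the summands is kept.
\<close>

fun summand_numerators :: "summand \<Rightarrow> (real \<Rightarrow> real poly) set"
  where
    "summand_numerators (Full d) = {\<lambda>s. monom (h s) d | h. True}"
  | "summand_numerators (Zero_Mean d) = {\<lambda>s. monom (h s) d | h. mean h = 0}"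
  | "summand_numerators Extra = {\<lambda>s. p | p. \<forall>n. coeff p n \<noteq> 0 \<longrightarrow> odd n \<and> n \<ge> 3}"

lemma summand_space_numerator:
  assumes "F \<in> summand_space i"
  shows "\<exists>q\<in>summand_numerators i. F = (\<lambda>(s, y). poly (q s) y / sqrt (1 + y\<^sup>2))"
proof (cases i)
  case (Full d)
  then obtain h where "F = H d h"
    using assms by (auto simp: Lam_def)
  then show ?thesis
    using Full by (auto simp: H_def poly_monom)
next
  case (Zero_Mean d)
  then obtain h where "F = H d h" "mean h = 0"
    using assms by (auto simp: Lam0_iff)
  then show ?thesis
    using Zero_Mean by (auto simp: H_def poly_monom)
next
  case Extra
  then obtain k a where
    F: "F = (\<lambda>(s, y). (\<Sum>j=1..k. a j * y ^ (2 * j + 1)) / sqrt (1 + y\<^sup>2))"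
    using assms by (auto simp: Psi_def)
  define p where "p = (\<Sum>j=1..k. monom (a j) (2 * j + 1))"
  have "odd n \<and> n \<ge> 3" if "coeff p n \<noteq> 0" for n
  proof -
    from that have "\<exists>j\<in>{1..k}. coeff (monom (a j) (2 * j + 1)) n \<noteq> 0"
      unfolding p_def coeff_sum by (meson sum.neutral)
    then show ?thesis
      by (auto simp: coeff_monom split: if_splits)
  qed
  then have "(\<lambda>s. p) \<in> summand_numerators i"
    using Extra by auto
  moreover have "F = (\<lambda>(s, y). poly p y / sqrt (1 + y\<^sup>2))"
    unfolding F p_def by (simp add: poly_sum poly_monom)
  ultimately show ?thesis
    by (intro bexI[of _ "\<lambda>s. p"])
qed

text \<open>
  \<open>Extra\<close> is not homogeneous, and its value is a dummy.
\<close>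

fun summand_degree :: "summand \<Rightarrow> nat"
  where
    "summand_degree (Full d) = d"
  | "summand_degree (Zero_Mean d) = d"
  | "summand_degree Extra = 0"

lemma summand_degree_inj:
  assumes "i \<in> summands" "j \<in> summands" "i \<noteq> Extra" "j \<noteq> Extra" "summand_degree i = summand_degree j"
  shows "i = j"
  using assms by auto presburger+

lemma summand_of_odd_degree:
  assumes "i \<in> summands" "i \<noteq> Extra" "odd (summand_degree i)" "summand_degree i \<ge> 3"
  shows "i = Zero_Mean (summand_degree i)"
  using assms by auto

lemma coeff_numerator_other:
  "q \<in> summand_numerators i \<Longrightarrow> i \<noteq> Extra \<Longrightarrow> n \<noteq> summand_degree i \<Longrightarrow> coeff (q s) n = 0"
  by (cases i) (auto simp: coeff_monom)

text \<open>
  A homogeneous summand shares its power of \<open>y\<close> with no summand other than \<open>Extra\<close>. So it is enough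
  to eliminate \<open>Extra\<close>: its coefficient in degree \<open>n\<close> is a constant that has to cancel either
  nothing or the zero-mean coefficient of \<open>Zero_Mean n\<close>, hence it is zero.
\<close>

lemma numerators_independent:
  assumes J: "finite J" "J \<subseteq> summands"
    and q: "\<And>i. i \<in> J \<Longrightarrow> q i \<in> summand_numerators i"
    and sum0: "\<And>s. (\<Sum>i\<in>J. q i s) = 0"
    and i: "i \<in> J"
  shows "q i s = 0"
proof -
  have coeffs: "(\<Sum>j\<in>J. coeff (q j s) n) = 0" for s n
    using arg_cong[OF sum0, of "\<lambda>p. coeff p n"] by (simp add: coeff_sum)
  have isolate: "coeff (q j s) (summand_degree j) +
      (if Extra \<in> J then coeff (q Extra s) (summand_degree j) else 0) = 0"
    if j: "j \<in> J" "j \<noteq> Extra" for j s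
  proof -
    let ?c = "\<lambda>l. coeff (q l s) (summand_degree j)"
    have "?c l = 0" if "l \<in> J - {j} - {Extra}" for l
    proof -
      have l: "l \<in> J" "l \<noteq> Extra" "l \<noteq> j" using that by blast+
      then have "summand_degree j \<noteq> summand_degree l"
        using summand_degree_inj[OF subsetD[OF J(2) l(1)] subsetD[OF J(2) j(1)] l(2) j(2)] by auto
      then show ?thesis
        using coeff_numerator_other[OF q[OF l(1)] l(2)] by blast
    qed
    then have "(\<Sum>l\<in>J - {j} - {Extra}. ?c l) = 0"
      by (intro sum.neutral) blast
    moreover have "(\<Sum>l\<in>J - {j}. ?c l) =
        (if Extra \<in> J then ?c Extra else 0) + (\<Sum>l\<in>J - {j} - {Extra}. ?c l)"
    proof (cases "Extra \<in> J")
      case True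
      then show ?thesis using J(1) j sum.remove[of "J - {j}" Extra ?c] by simp
    qed simp
    moreover have "(\<Sum>l\<in>J. ?c l) = ?c j + (\<Sum>l\<in>J - {j}. ?c l)"
      using J(1) j(1) by (rule sum.remove)
    ultimately show ?thesis
      using coeffs[of s "summand_degree j"] by simp
  qed
  have extra: "q Extra s = 0" if E: "Extra \<in> J" for s
  proof (rule poly_eqI)
    fix n
    obtain p where p: "q Extra = (\<lambda>s. p)" "\<And>n. coeff p n \<noteq> 0 \<Longrightarrow> odd n \<and> n \<ge> 3"
      using q[OF E] by auto
    have "coeff p n = 0"
    proof (rule ccontr)
      assume nz: "coeff p n \<noteq> 0"
      then have n: "odd n" "n \<ge> 3" using p(2) by auto
      show False
      proof (cases "Zero_Mean n \<in> J")
        case True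
        then obtain h where h: "q (Zero_Mean n) = (\<lambda>s. monom (h s) n)" "mean h = 0"
          using q[OF True] by auto
        have "h s = - coeff p n" for s
          using isolate[OF True, of s] E by (simp add: h p)
        then have "h = (\<lambda>s. - coeff p n)" by blast
        then have "mean h = - coeff p n" by simp
        then show False using h(2) nz by simp
      next
        case False
        have "coeff (q l s) n = 0" if "l \<in> J - {Extra}" for l
        proof -
          have l: "l \<in> J" "l \<noteq> Extra" using that by blast+
          then have "n \<noteq> summand_degree l"
            using summand_of_odd_degree[OF subsetD[OF J(2) l(1)] l(2)] n False by auto
          then show ?thesis
            using coeff_numerator_other[OF q[OF l(1)] l(2)] by blast
        qed
        then have "(\<Sum>l\<in>J. coeff (q l s) n) = coeff p n"
          using sum.remove[OF J(1) E, of "\<lambda>l. coeff (q l s) n"] by (simp add: p)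
        then show False using coeffs nz by simp
      qed
    qed
    then show "coeff (q Extra s) n = coeff 0 n" by (simp add: p)
  qed
  show ?thesis
  proof (cases "i = Extra")
    case True
    then show ?thesis using extra i by simp
  next
    case False
    have "coeff (q i s) (summand_degree i) = 0"
      using isolate[OF i False, of s] extra[of s] by (simp split: if_splits)
    then show ?thesis
      using coeff_numerator_other[OF q[OF i] False] by (metis coeff_0 poly_eqI)
  qed
qed

lemma summands_independent:
  assumes J: "finite J" "J \<subseteq> summands"
    and v: "\<forall>i\<in>J. v i \<in> summand_space i"
    and sum0: "(\<Sum>i\<in>J. v i) = 0"
    and i: "i \<in> J"
  shows "v i = 0"
proof -
  have "\<forall>i\<in>J. \<exists>q. q \<in> summand_numerators i \<and> v i = (\<lambda>(s, y). poly (q s) y / sqrt (1 + y\<^sup>2))"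
  proof
    fix i assume "i \<in> J"
    then show "\<exists>q. q \<in> summand_numerators i \<and> v i = (\<lambda>(s, y). poly (q s) y / sqrt (1 + y\<^sup>2))"
      using summand_space_numerator[of "v i" i] v by blast
  qed
  from bchoice[OF this] obtain q where q: "\<And>i. i \<in> J \<Longrightarrow> q i \<in> summand_numerators i"
    "\<And>i. i \<in> J \<Longrightarrow> v i = (\<lambda>(s, y). poly (q i s) y / sqrt (1 + y\<^sup>2))"
    by blast
  have "(\<Sum>i\<in>J. q i s) = 0" for s
  proof -
    have "poly (\<Sum>i\<in>J. q i s) y = 0" for y
    proof -
      have "poly (\<Sum>i\<in>J. q i s) y / sqrt (1 + y\<^sup>2) = (\<Sum>i\<in>J. v i (s, y))"
        by (simp add: poly_sum sum_divide_distrib q(2))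
      also have "\<dots> = (\<Sum>i\<in>J. v i) (s, y)"
        by (simp only: sum_apply)
      finally have "poly (\<Sum>i\<in>J. q i s) y / sqrt (1 + y\<^sup>2) = 0"
        by (simp add: sum0)
      then show ?thesis
        by (simp add: add_nonneg_eq_0_iff)
    qed
    then show ?thesis
      using poly_all_0_iff_0 by blast
  qed
  then have "q i s = 0" for s
    using numerators_independent[OF J q(1) _ i] by blast
  then show ?thesis
    using q(2)[OF i] by (auto simp: fun_eq_iff)
qed

theorem theorem1p22:
  shows "is_direct_sum
    (poisson_lie_algebra {H 0 f | f. f \<in> smooth_circle})
    ({Full 1} \<union> {Full (2 * m) | m. True} \<union> {Zero_Mean (2 * m + 1) | m. m \<ge> 1} \<union> {Extra})
    summand_space"
  unfolding is_direct_sum_def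
proof (intro conjI ballI allI impI)
  show "subspace (summand_space i)" for i
    by (rule subspace_summand_space)
  have "generated_algebra = target_space"
    using generated_algebra_subset_target target_subset_generated_algebra by (rule subset_antisym)
  also have "\<dots> = {(\<Sum>i\<in>J. v i) | J v.
      finite J \<and> J \<subseteq> summands \<and> (\<forall>i\<in>J. v i \<in> summand_space i)}"
    unfolding target_space_def by (rule span_Union_subspaces) (rule subspace_summand_space)
  finally show "generated_algebra = {(\<Sum>i\<in>J. v i) | J v.
      finite J \<and> J \<subseteq> summands \<and> (\<forall>i\<in>J. v i \<in> summand_space i)}" .
next
  fix J v i
  assume "finite J" "J \<subseteq> summands" "\<forall>i\<in>J. v i \<in> summand_space i"
    "(\<Sum>i\<in>J. v i) = 0" "i \<in> J"
  then show "v i = 0"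
    by (rule summands_independent)
qed

end
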